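(* Let $S$ be a numerical semigroup with genus $g$ and multiplicity $m$. If $g<2m-\sqrt{2m}$, then $S$ satisfies Wilf's conjecture.
   Context: $\mathbb{N}$ is the set of nonnegative integers. A numerical semigroup is a subset $S\subseteq\mathbb{N}$ that contains $0$, is closed under addition, and has finite complement in $\mathbb{N}$. The genus of $S$ is $|\mathbb{N}\setminus S|$. Every numerical semigroup $S$ has a unique minimal generating set, which is finite; it is denoted $P(S)$. The multiplicity of $S$ is $\min P(S)$ (equivalently, the least positive element of $S$). For $S\neq\mathbb{N}$ the Frobenius number $F(S)$ is the largest element of $\mathbb{N}\setminus S$; by convention $F(\mathbb{N})=-1$. The set of left elements of $S$ is $L(S)=\{s\in S: s<F(S)\}$. One says that $S$ satisfies Wilf's conjecture if $|P(S)|\cdot|L(S)|\ge F(S)+1$. *)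

theory Defs
  imports Complex_Main "HOL.Hull"
begin

definition add_submonoid :: "nat set \<Rightarrow> bool" where
  "add_submonoid T \<longleftrightarrow> 0 \<in> T \<and> (\<forall>x\<in>T. \<forall>y\<in>T. x + y \<in> T)"

definition numerical_semigroup :: "nat set \<Rightarrow> bool" where
  "numerical_semigroup S \<longleftrightarrow> add_submonoid S \<and> finite (- S)"

definition genus :: "nat set \<Rightarrow> nat" where
  "genus S = card (- S)"

definition generates :: "nat set \<Rightarrow> nat set \<Rightarrow> bool" where
  "generates A S \<longleftrightarrow> add_submonoid hull A = S"

definition minimal_generating_set :: "nat set \<Rightarrow> nat set \<Rightarrow> bool" where
  "minimal_generating_set A S \<longleftrightarrow> generates A S \<and> (\<forall>B. B \<subset> A \<longrightarrow> \<not> generates B S)"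

(* P(S); well defined and finite for a numerical semigroup S by the lemmas
   ex1_minimal_generating_set and finite_min_gens below *)
definition min_gens :: "nat set \<Rightarrow> nat set" where
  "min_gens S = (THE A. minimal_generating_set A S)"

definition multiplicity :: "nat set \<Rightarrow> nat" where
  "multiplicity S = Min (min_gens S)"

definition frobenius :: "nat set \<Rightarrow> int" where
  "frobenius S = (if S = UNIV then -1 else int (Max (- S)))"

definition left_elements :: "nat set \<Rightarrow> nat set" where
  "left_elements S = {s \<in> S. int s < frobenius S}"

definition satisfies_wilf :: "nat set \<Rightarrow> bool" where
  "satisfies_wilf S \<longleftrightarrow>
     int (card (min_gens S)) * int (card (left_elements S)) \<ge> frobenius S + 1"

lemma add_submonoid_hull: "add_submonoid (add_submonoid hull A)"
  by (rule hull_in) (auto simp: add_submonoid_def)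

definition atoms :: "nat set \<Rightarrow> nat set" where
  "atoms S = {x \<in> S. x \<noteq> 0 \<and> \<not> (\<exists>a\<in>S. \<exists>b\<in>S. a \<noteq> 0 \<and> b \<noteq> 0 \<and> x = a + b)}"

lemma atoms_subset_generating:
  assumes "generates A S"
  shows "atoms S \<subseteq> A"
proof -
  have S: "add_submonoid S" and A: "A \<subseteq> S"
    using assms add_submonoid_hull[of A] hull_subset[of A add_submonoid]
    by (auto simp: generates_def)
  let ?T = "{x \<in> S. x \<in> atoms S \<longrightarrow> x \<in> A}"
  have closed: "x + y \<in> ?T" if "x \<in> ?T" "y \<in> ?T" for x y
  proof (cases "x = 0 \<or> y = 0")
    case True
    then show ?thesis using that by auto
  next
    case False
    then have "x + y \<notin> atoms S" using that by (auto simp: atoms_def)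
    then show ?thesis using that S by (auto simp: add_submonoid_def)
  qed
  have "0 \<in> ?T" using S by (auto simp: add_submonoid_def atoms_def)
  with closed have "add_submonoid ?T" unfolding add_submonoid_def by blast
  then have "add_submonoid hull A \<subseteq> ?T" using A by (intro hull_minimal) auto
  then show ?thesis using assms by (auto simp: generates_def atoms_def)
qed

lemma generates_atoms:
  assumes "add_submonoid S"
  shows "generates (atoms S) S"
proof -
  let ?H = "add_submonoid hull atoms S"
  have zero: "0 \<in> ?H" and plus: "\<And>x y. x \<in> ?H \<Longrightarrow> y \<in> ?H \<Longrightarrow> x + y \<in> ?H"
    using add_submonoid_hull[of "atoms S"] by (simp_all only: add_submonoid_def[of ?H])
  have "x \<in> S \<Longrightarrow> x \<in> ?H" for x
  proof (induction x rule: less_induct)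
    case (less x)
    consider "x = 0" | "x \<in> atoms S"
      | a b where "a \<in> S" "b \<in> S" "a \<noteq> 0" "b \<noteq> 0" "x = a + b"
      using less.prems by (auto simp: atoms_def)
    then show ?case
    proof cases
      case 1
      then show ?thesis using zero by (simp only:)
    next
      case 2
      then show ?thesis by (rule hull_inc)
    next
      case 3
      then have "a \<in> ?H" "b \<in> ?H" using less.IH by auto
      then show ?thesis unfolding \<open>x = a + b\<close> by (rule plus)
    qed
  qed
  moreover have "?H \<subseteq> S" by (rule hull_minimal) (auto simp: atoms_def assms)
  ultimately show ?thesis by (auto simp: generates_def)
qed

lemma minimal_generating_set_iff_atoms:
  assumes "add_submonoid S"
  shows "minimal_generating_set A S \<longleftrightarrow> A = atoms S"
  using atoms_subset_generating generates_atoms[OF assms]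
  unfolding minimal_generating_set_def by blast

lemma ex1_minimal_generating_set:
  assumes "numerical_semigroup S"
  shows "\<exists>!A. minimal_generating_set A S"
  using assms by (simp add: numerical_semigroup_def minimal_generating_set_iff_atoms)

lemma min_gens_eq_atoms:
  assumes "numerical_semigroup S"
  shows "min_gens S = atoms S"
  using assms
  by (simp add: numerical_semigroup_def minimal_generating_set_iff_atoms min_gens_def)

lemma finite_min_gens:
  assumes "numerical_semigroup S"
  shows "finite (min_gens S)"
proof -
  have "finite (- S)" using assms by (simp add: numerical_semigroup_def)
  then obtain N where N: "\<And>x. x \<notin> S \<Longrightarrow> x \<le> N"
    by (metis ComplI finite_nat_set_iff_bounded_le)
  have "x \<le> 2 * N + 1" if "x \<in> atoms S" for x
  proof (rule ccontr)
    assume "\<not> x \<le> 2 * N + 1"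
    then have "\<not> N + 1 \<le> N" "\<not> x - (N + 1) \<le> N" by linarith+
    then have "N + 1 \<in> S" "x - (N + 1) \<in> S" using N by blast+
    moreover have "x - (N + 1) \<noteq> 0" "x = (N + 1) + (x - (N + 1))" "N + 1 \<noteq> 0"
      using \<open>\<not> x \<le> 2 * N + 1\<close> by auto
    moreover have "\<not> (\<exists>a\<in>S. \<exists>b\<in>S. a \<noteq> 0 \<and> b \<noteq> 0 \<and> x = a + b)"
      using that by (simp add: atoms_def)
    ultimately show False by metis
  qed
  then have "atoms S \<subseteq> {..2 * N + 1}" by auto
  then show ?thesis using assms by (simp add: min_gens_eq_atoms finite_subset)
qed

lemma min_gens_nonempty:
  assumes "numerical_semigroup S"
  shows "min_gens S \<noteq> {}"
proof
  assume "min_gens S = {}"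
  then have "generates {} S"
    using assms generates_atoms by (metis min_gens_eq_atoms numerical_semigroup_def)
  moreover have "add_submonoid hull {} \<subseteq> {0}"
    by (rule hull_minimal) (auto simp: add_submonoid_def)
  ultimately have "finite S" by (auto simp: generates_def intro: finite_subset)
  then show False using assms by (auto simp: numerical_semigroup_def)
qed

end

theory Submission
  imports Defs
begin

text \<open>
  Let \<open>c = F + 1\<close>. Every element of \<open>S\<close> in \<open>[m, 2m)\<close> is a minimal generator.

  If \<open>c > 2m\<close>, there is a gap outside \<open>[0, 2m)\<close>, so counting gaps gives
  \<open>|P| \<ge> |S \<inter> [m, 2m)| \<ge> 2m - g > sqrt (2m)\<close>, whereas
  \<open>|L| = c - g > (c - 2m) + sqrt (2m)\<close>; the product of the two bounds exceeds \<open>c\<close>.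

  If \<open>c \<le> 2m\<close>, put \<open>A = S \<inter> [m, c)\<close> and
  \<open>l = |A|\<close>, so that \<open>|L| = l + 1\<close>. Then \<open>|P| \<ge> l + 2m - c\<close>. Moreover, an element of
  \<open>A \<union> [c, c + m)\<close> that is not a minimal generator lies in \<open>A + A\<close>, whence
  \<open>|P| \<ge> l + m - l (l + 1) / 2\<close>. The first bound suffices if \<open>l (l + 1) \<ge> 2m\<close>, the second otherwise.
\<close>

text \<open>By commutativity, inserting \<open>x\<close> creates only the sums \<open>x + b\<close>
  with \<open>b\<close> in \<open>insert x A\<close>, hence at most \<open>card A + 1\<close> new
  ones.\<close>

lemma card_sumset_le:
  fixes A :: "'a::ab_semigroup_add set"
  assumes "finite A"
  shows "2 * card {a + b | a b. a \<in> A \<and> b \<in> A} \<le> card A * (card A + 1)"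
  using assms
proof (induction A rule: finite_induct)
  case empty
  then show ?case by simp
next
  case (insert x A)
  let ?D = "\<lambda>A. {a + b | a b. a \<in> A \<and> b \<in> A}"
  have fin: "finite (?D A)" using insert.hyps by (intro finite_image_set2) simp_all
  have "?D (insert x A) \<subseteq> ?D A \<union> (+) x ` insert x A"
    by (auto simp: add.commute)
  then have "card (?D (insert x A)) \<le> card (?D A \<union> (+) x ` insert x A)"
    using fin insert.hyps by (intro card_mono) auto
  also have "\<dots> \<le> card (?D A) + card ((+) x ` insert x A)"
    by (rule card_Un_le)
  also have "card ((+) x ` insert x A) \<le> card (insert x A)"
    using insert.hyps by (intro card_image_le) simp
  finally show ?case using insert by (simp add: algebra_simps)
qed

lemma multiplicity_in:
  assumes "numerical_semigroup S"
  shows "multiplicity S \<in> S" "0 < multiplicity S"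
  using Min_in[OF finite_min_gens[OF assms] min_gens_nonempty[OF assms]]
  by (auto simp: multiplicity_def min_gens_eq_atoms[OF assms] atoms_def)

lemma multiplicity_le:
  assumes S: "numerical_semigroup S"
  shows "x \<in> S \<Longrightarrow> x \<noteq> 0 \<Longrightarrow> multiplicity S \<le> x"
proof (induction x rule: less_induct)
  case (less x)
  show ?case
  proof (cases "x \<in> atoms S")
    case True
    then show ?thesis
      using finite_min_gens[OF S] by (simp add: multiplicity_def min_gens_eq_atoms[OF S])
  next
    case False
    then obtain a b where "a \<in> S" "a \<noteq> 0" "b \<noteq> 0" "x = a + b"
      using less.prems by (auto simp: atoms_def)
    then show ?thesis using less.IH[of a] by simp
  qed
qed

text \<open>A sum of two nonzero elements of \<open>S\<close> is at least twice the multiplicity, so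
  nothing in this interval decomposes.\<close>

lemma card_le_card_min_gens:
  assumes S: "numerical_semigroup S"
  shows "card (S \<inter> {multiplicity S..<2 * multiplicity S}) \<le> card (min_gens S)"
proof (intro card_mono finite_min_gens[OF S] subsetI)
  fix x assume x: "x \<in> S \<inter> {multiplicity S..<2 * multiplicity S}"
  have "x \<noteq> a + b" if "a \<in> S" "b \<in> S" "a \<noteq> 0" "b \<noteq> 0" for a b
    using x multiplicity_le[OF S that(1,3)] multiplicity_le[OF S that(2,4)] by auto
  then show "x \<in> min_gens S"
    using x multiplicity_in(2)[OF S] by (auto simp: min_gens_eq_atoms[OF S] atoms_def)
qed

lemma card_min_gens_ge_sumset:
  assumes S: "numerical_semigroup S"
    and c: "{c..} \<subseteq> S" "multiplicity S \<le> c"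
    and l: "l = card (S \<inter> {multiplicity S..<c})"
  shows "2 * multiplicity S + 2 * l \<le> 2 * card (min_gens S) + l * (l + 1)"
proof -
  let ?m = "multiplicity S"
  let ?A = "S \<inter> {?m..<c}"
  let ?D = "{a + b | a b. a \<in> ?A \<and> b \<in> ?A}"
  have finD: "finite ?D" by (intro finite_image_set2) simp_all
  have "?A \<union> {c..<c + ?m} \<subseteq> min_gens S \<union> ?D"
  proof
    fix x assume x: "x \<in> ?A \<union> {c..<c + ?m}"
    show "x \<in> min_gens S \<union> ?D"
    proof (cases "x \<in> atoms S")
      case True
      then show ?thesis by (simp add: min_gens_eq_atoms[OF S])
    next
      case False
      moreover have "x \<in> S" "x \<noteq> 0" "x < c + ?m"
        using x c multiplicity_in(2)[OF S] by auto
      ultimately obtain a b where ab: "a \<in> S" "b \<in> S" "a \<noteq> 0" "b \<noteq> 0" "x = a + b"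
        by (auto simp: atoms_def)
      moreover from ab have "?m \<le> a" "?m \<le> b" using multiplicity_le[OF S] by auto
      \<comment> \<open>Each summand is at least \<open>?m\<close> while \<open>x < c + ?m\<close>,
        so the other one is below \<open>c\<close>.\<close>
      ultimately have "a \<in> ?A" "b \<in> ?A" using \<open>x < c + ?m\<close> by auto
      then show ?thesis using \<open>x = a + b\<close> by blast
    qed
  qed
  then have "card (?A \<union> {c..<c + ?m}) \<le> card (min_gens S \<union> ?D)"
    using finite_min_gens[OF S] finD by (intro card_mono) auto
  also have "\<dots> \<le> card (min_gens S) + card ?D" by (rule card_Un_le)
  also have "card (?A \<union> {c..<c + ?m}) = l + ?m"
    unfolding l by (subst card_Un_disjoint) auto
  finally show ?thesis using card_sumset_le[of ?A] l by simp
qed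

context
  fixes S :: "nat set"
  assumes S: "numerical_semigroup S" and proper: "S \<noteq> UNIV"
begin

definition conductor :: nat where
  "conductor = Suc (Max (- S))"

lemma frobenius_conductor: "frobenius S + 1 = int conductor"
  using proper by (simp add: frobenius_def conductor_def)

lemma Max_gap: "finite (- S)" "Max (- S) \<notin> S"
  using S proper Max_in[of "- S"] by (auto simp: numerical_semigroup_def)

lemma conductor_le: "{conductor..} \<subseteq> S"
proof
  fix x assume "x \<in> {conductor..}"
  then have "\<not> x \<le> Max (- S)" by (simp add: conductor_def)
  then show "x \<in> S" using Max_gap(1) Max_ge by blast
qed

text \<open>The bound can be raised from \<open>s < F\<close> to \<open>s < F + 1\<close> because
  \<open>F\<close> itself is a gap.\<close>

lemma left_elements_conductor: "left_elements S = S \<inter> {..<conductor}"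
  using Max_gap proper
  by (auto simp: left_elements_def frobenius_def conductor_def less_Suc_eq)

lemma multiplicity_le_conductor: "multiplicity S \<le> conductor"
proof (cases "multiplicity S - 1 \<in> S")
  case True
  \<comment> \<open>The only element of \<open>S\<close> below the multiplicity is 0.\<close>
  then have "multiplicity S = 1"
    using multiplicity_le[OF S, of "multiplicity S - 1"] multiplicity_in(2)[OF S] by fastforce
  then show ?thesis by (simp add: conductor_def)
next
  case False
  then have "multiplicity S - 1 \<le> Max (- S)" using Max_gap by simp
  then show ?thesis by (simp add: conductor_def)
qed

text \<open>All gaps lie below the conductor, so left elements and gaps partition
  \<open>{..<conductor}\<close>.\<close>

lemma card_left_elements_genus: "card (left_elements S) + genus S = conductor"
proof -
  have "left_elements S \<union> - S = {..<conductor}"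
    using conductor_le by (auto simp: left_elements_conductor not_le[symmetric])
  then have "card (left_elements S \<union> - S) = conductor" by simp
  then show ?thesis
    using Max_gap by (subst (asm) card_Un_disjoint) (auto simp: left_elements_conductor genus_def)
qed

lemma card_left_elements:
  "card (left_elements S) = 1 + card (S \<inter> {multiplicity S..<conductor})"
proof -
  have "left_elements S = insert 0 (S \<inter> {multiplicity S..<conductor})"
    using S multiplicity_le[OF S]
    by (auto simp: left_elements_conductor conductor_def numerical_semigroup_def
        add_submonoid_def)
  then show ?thesis using multiplicity_in(2)[OF S] by simp
qed

lemma wilf_if_conductor_le:
  assumes le: "conductor \<le> 2 * multiplicity S"
  shows "satisfies_wilf S"
proof -
  let ?m = "multiplicity S" and ?e = "card (min_gens S)"
  define l where "l = card (S \<inter> {?m..<conductor})"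
  have "S \<inter> {?m..<2 * ?m} = (S \<inter> {?m..<conductor}) \<union> {conductor..<2 * ?m}"
    using conductor_le multiplicity_le_conductor le by auto
  also have "card \<dots> = l + (2 * ?m - conductor)"
    unfolding l_def by (subst card_Un_disjoint) auto
  finally have e1: "l + (2 * ?m - conductor) \<le> ?e"
    using card_le_card_min_gens[OF S] by simp
  have e2: "2 * ?m + 2 * l \<le> 2 * ?e + l * (l + 1)"
    using card_min_gens_ge_sumset[OF S conductor_le multiplicity_le_conductor l_def] .
  have "conductor \<le> ?e * (1 + l)"
  proof (cases "l = 0")
    case True
    \<comment> \<open>Otherwise \<open>?m\<close> itself would be counted by \<open>l\<close>. Hence
      \<open>conductor \<le> ?m\<close>, and \<open>e1\<close> gives
      \<open>?m \<le> ?e\<close>.\<close>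
    have "\<not> ?m < conductor"
      using True multiplicity_in(1)[OF S] by (auto simp: l_def)
    then show ?thesis using e1 True by simp
  next
    case False
    show ?thesis
    proof (cases "2 * ?m \<le> l * (l + 1)")
      case True
      have "conductor \<le> 2 * ?m" by (rule le)
      also have "\<dots> \<le> l * (l + 1)" by (rule True)
      also have "\<dots> \<le> ?e * (l + 1)" using e1 by (intro mult_right_mono) auto
      finally show ?thesis by simp
    next
      case small: False
      \<comment> \<open>This product is exactly the difference of the two sides of the next
        inequality. Integers avoid truncated subtraction.\<close>
      have "0 \<le> (int l - 1) * (2 * int ?m - int l * (int l + 1))"
      proof (intro mult_nonneg_nonneg)
        show "0 \<le> int l - 1" using False by simp
        have "int (l * (l + 1)) \<le> int (2 * ?m)" using small by linarith
        then show "0 \<le> 2 * int ?m - int l * (int l + 1)" by (simp add: algebra_simps)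
      qed
      then have "4 * int ?m \<le> (2 * int ?m + 2 * int l - int l * (int l + 1)) * (1 + int l)"
        by (simp add: algebra_simps)
      also have "\<dots> \<le> (2 * int ?e) * (1 + int l)"
      proof (intro mult_right_mono)
        have "int (2 * ?m + 2 * l) \<le> int (2 * ?e + l * (l + 1))" using e2 by linarith
        then show "2 * int ?m + 2 * int l - int l * (int l + 1) \<le> 2 * int ?e"
          by (simp add: algebra_simps)
      qed simp
      finally have "int (2 * ?m) \<le> int (?e * (1 + l))" by (simp add: algebra_simps)
      then show ?thesis using le by linarith
    qed
  qed
  then have "int conductor \<le> int (?e * (1 + l))" by (simp only: of_nat_le_iff)
  then show ?thesis
    unfolding satisfies_wilf_def frobenius_conductor card_left_elements l_def[symmetric]
    by (simp only: of_nat_mult)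
qed

lemma genus_ge:
  assumes "2 * multiplicity S < conductor"
  shows "2 * multiplicity S \<le> genus S + card (min_gens S)"
proof -
  let ?m = "multiplicity S"
  \<comment> \<open>The gap \<open>Max (- S)\<close> is at least \<open>2 * ?m\<close>, hence new;
    it makes up for 0, which is not a gap, and so saves 1 in the bound.\<close>
  let ?G = "{1..<?m} \<union> ({?m..<2 * ?m} - S) \<union> {Max (- S)}"
  have "?G \<subseteq> - S" using multiplicity_le[OF S] Max_gap by force
  then have "card ?G \<le> genus S" using Max_gap by (simp add: genus_def card_mono)
  moreover have "card ?G = (?m - 1) + card ({?m..<2 * ?m} - S) + 1"
    using assms by (subst card_Un_disjoint; (subst card_Un_disjoint)?) (auto simp: conductor_def)
  moreover have "card ({?m..<2 * ?m} - S) + card (S \<inter> {?m..<2 * ?m}) = ?m"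
    using card_Diff_subset_Int[of "{?m..<2 * ?m}" S] card_mono[of "{?m..<2 * ?m}" "S \<inter> {?m..<2 * ?m}"]
    by (simp add: Int_commute)
  ultimately show ?thesis
    using card_le_card_min_gens[OF S] multiplicity_in(2)[OF S] by linarith
qed

lemma wilf_if_conductor_gt:
  assumes gt: "2 * multiplicity S < conductor"
    and g: "real (genus S) < 2 * real (multiplicity S) - sqrt (2 * real (multiplicity S))"
  shows "satisfies_wilf S"
proof -
  let ?e = "card (min_gens S)" and ?L = "card (left_elements S)"
  define m where "m = multiplicity S"
  define r where "r = sqrt (2 * real m)"
  have rr: "r * r = 2 * real m" by (simp add: r_def)
  have r1: "1 \<le> r" using multiplicity_in(2)[OF S] by (simp add: r_def m_def)
  have e: "r \<le> real ?e" using genus_ge[OF gt] g by (simp add: r_def m_def)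
  have L: "real conductor - 2 * real m + r \<le> real ?L"
    using card_left_elements_genus g by (simp add: r_def m_def)
  \<comment> \<open>Scaling the excess over \<open>2 * real m\<close> by \<open>r \<ge> 1\<close>
    only increases it, and the missing \<open>2 * real m\<close> is then supplied by
    \<open>r * r\<close>.\<close>
  have "real conductor - 2 * real m \<le> r * (real conductor - 2 * real m)"
    using r1 gt mult_right_mono[of 1 r "real conductor - 2 * real m"] by (simp add: m_def)
  then have "real conductor \<le> r * (real conductor - 2 * real m + r)"
    by (simp add: distrib_left rr)
  also have "\<dots> \<le> real ?e * real ?L" using e L r1 gt by (intro mult_mono) (auto simp: m_def)
  finally have "conductor \<le> ?e * ?L" by (simp flip: of_nat_mult)
  then have "int conductor \<le> int (?e * ?L)" by (simp only: of_nat_le_iff)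
  then show ?thesis unfolding satisfies_wilf_def frobenius_conductor by simp
qed

end

theorem corollary1p6:
  fixes S :: "nat set" and g m :: nat
  assumes "numerical_semigroup S"
    and "g = genus S"
    and "m = multiplicity S"
    and "real g < 2 * real m - sqrt (2 * real m)"
  shows "satisfies_wilf S"
proof (cases "S = UNIV")
  case True
  \<comment> \<open>By convention \<open>F + 1 = 0\<close> here, so the inequality is
    trivial.\<close>
  then show ?thesis by (simp add: satisfies_wilf_def frobenius_def)
next
  case False
  then show ?thesis
    using wilf_if_conductor_le[OF assms(1) False] wilf_if_conductor_gt[OF assms(1) False] assms
    by (metis not_le)
qed

end
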